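(* There exists a constant $C>0$ such that for every positive integer $n$ there is a maximal Sidon set $S\subseteq\mathbb{Z}_2^n$ with $|S|\le C\,(n\cdot 2^n)^{1/3}$; that is, $|S|=O\big((n\cdot 2^n)^{1/3}\big)$.
   Context: A subset $S\subseteq\mathbb{Z}_2^n$ is called Sidon if whenever $a+b=x+y$ with $a,b,x,y\in S$, $a\neq b$, $x\neq y$, we have $\{a,b\}=\{x,y\}$ (i.e. the sums of pairs of distinct elements of $S$ are all distinct). A Sidon set $S$ is maximal if there is no Sidon set $S'\subseteq\mathbb{Z}_2^n$ with $S\subsetneq S'$. *)

theory Defs
  imports Complex_Main "HOL-Library.Z2" "Jordan_Normal_Form.Matrix"
begin

(* The group \<int>_2^n is the set carrier_vec n of vectors of dimension n over the
   two-element field bit, under componentwise addition. *)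

definition sidon_set :: "nat \<Rightarrow> bit vec set \<Rightarrow> bool" where
  "sidon_set n S \<longleftrightarrow> S \<subseteq> carrier_vec n \<and>
     (\<forall>a\<in>S. \<forall>b\<in>S. \<forall>x\<in>S. \<forall>y\<in>S.
        a + b = x + y \<and> a \<noteq> b \<and> x \<noteq> y \<longrightarrow> {a, b} = {x, y})"

definition maximal_sidon_set :: "nat \<Rightarrow> bit vec set \<Rightarrow> bool" where
  "maximal_sidon_set n S \<longleftrightarrow> sidon_set n S \<and> (\<nexists>S'. sidon_set n S' \<and> S \<subset> S')"

end

theory Submission
  imports Defs "HOL-Algebra.Algebraic_Closure_Type" "HOL-Library.Product_Plus"
begin

text \<open>
  Let \<open>F\<close> be the field with \<open>2 ^ j\<close> elements, \<open>j\<close> odd. The curve \<open>B = {(x, x ^ 3)}\<close> is a Sidon set in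
  \<open>F \<times> F\<close>, and every \<open>u\<close> off the curve is the sum of about \<open>card F / 6\<close> three-element subsets of \<open>B\<close>,
  because cubing is a bijection of \<open>F\<close>. As \<open>B\<close> is Sidon, the triples with a given sum are pairwise
  disjoint, so for a random function \<open>f : B \<rightarrow> V\<close> into \<open>V = \<int>\<^sub>2 ^ (n - 2 j)\<close> the sums of \<open>f\<close> over them are
  independent. If \<open>card F\<close> is a large multiple of \<open>n * card V\<close>, that is, if \<open>8 ^ j\<close> is of order
  \<open>n * 2 ^ n\<close>, a union bound gives an \<open>f\<close> whose graph has every \<open>(u, v)\<close> with \<open>u \<notin> B\<close> as a sum of three
  distinct points. A maximal Sidon set \<open>S\<close> containing the graph therefore lies in \<open>B \<times> V\<close>, and
  \<open>(b, v) \<mapsto> v + f b\<close> is injective on the points of \<open>S\<close> outside the graph, whence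
  \<open>card S \<le> card B + card V\<close>.
\<close>

section \<open>Sidon sets, disjoint triples and the union bound\<close>

text \<open>\<open>sidon_set\<close> without its carrier, for any additive type, so that the
  construction can take place in products of fields.\<close>

definition sidon :: "'a::plus set \<Rightarrow> bool" where
  "sidon S \<longleftrightarrow> (\<forall>a\<in>S. \<forall>b\<in>S. \<forall>x\<in>S. \<forall>y\<in>S.
     a + b = x + y \<and> a \<noteq> b \<and> x \<noteq> y \<longrightarrow> {a, b} = {x, y})"

definition triples :: "'a::comm_monoid_add set \<Rightarrow> 'a \<Rightarrow> 'a set set" where
  "triples B u = {P. P \<subseteq> B \<and> card P = 3 \<and> \<Sum>P = u}"

lemma sidonD:
  assumes "sidon S" "a \<in> S" "b \<in> S" "x \<in> S" "y \<in> S" "a + b = x + y" "a \<noteq> b" "x \<noteq> y"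
  shows "{a, b} = {x, y}"
  using assms unfolding sidon_def by blast

lemma card_3_obtain:
  assumes "card P = 3" "x \<in> P"
  obtains y z where "P = {x, y, z}" "x \<noteq> y" "x \<noteq> z" "y \<noteq> z"
proof -
  have "card (P - {x}) = 2" using assms by simp
  then obtain y z where "P - {x} = {y, z}" "y \<noteq> z" by (auto simp: card_2_iff)
  then show thesis using that[of y z] assms(2) by auto
qed

text \<open>Removing a common point from two triples with the same sum leaves two pairs with equal
  sums, which coincide in a Sidon set.\<close>

lemma triples_disjoint:
  fixes B :: "'a::ab_group_add set"
  assumes B: "sidon B" and P: "P \<in> triples B u" and Q: "Q \<in> triples B u" and "P \<noteq> Q"
  shows "P \<inter> Q = {}"
proof (rule ccontr)
  assume "P \<inter> Q \<noteq> {}"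
  then obtain x where x: "x \<in> P" "x \<in> Q" by blast
  obtain y z where yz: "P = {x, y, z}" "x \<noteq> y" "x \<noteq> z" "y \<noteq> z"
    using card_3_obtain[of P x] P x(1) unfolding triples_def by auto
  obtain y' z' where yz': "Q = {x, y', z'}" "x \<noteq> y'" "x \<noteq> z'" "y' \<noteq> z'"
    using card_3_obtain[of Q x] Q x(2) unfolding triples_def by auto
  have "\<Sum>P = \<Sum>Q" using P Q by (simp add: triples_def)
  then have "y + z = y' + z'" using yz yz' by simp
  moreover have "y \<in> B" "z \<in> B" "y' \<in> B" "z' \<in> B"
    using P Q yz yz' by (auto simp: triples_def)
  ultimately have "{y, z} = {y', z'}" using sidonD[OF B] yz(4) yz'(4) by blast
  then show False using yz(1) yz'(1) \<open>P \<noteq> Q\<close> by blast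
qed

text \<open>Adding \<open>w \<in> V\<close> to the value of \<open>f\<close> at a point of the new set \<open>P\<close> moves \<open>sum f P\<close> through all
  of \<open>V\<close> without affecting the sums over the other sets, so each set removes at least a proportion
  \<open>1 / card V\<close> of the functions that avoid \<open>v\<close> so far.\<close>

lemma card_avoiding_functions:
  fixes V :: "'b::ab_group_add set"
  assumes fin: "finite B" "finite V" and V0: "0 \<in> V"
    and Vplus: "\<And>x y. x \<in> V \<Longrightarrow> y \<in> V \<Longrightarrow> x + y \<in> V"
    and Vneg: "\<And>x. x \<in> V \<Longrightarrow> - x \<in> V"
    and v: "v \<in> V"
    and T: "finite T" "\<And>P. P \<in> T \<Longrightarrow> P \<subseteq> B \<and> P \<noteq> {}" "disjoint T"
  shows "real (card {f \<in> B \<rightarrow>\<^sub>E V. \<forall>P\<in>T. sum f P \<noteq> v})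
      \<le> real (card V) ^ card B * (1 - 1 / real (card V)) ^ card T"
  using T
proof (induction T rule: finite_induct)
  case empty
  then show ?case using fin by (simp add: card_PiE)
next
  case (insert P T)
  define A where "A = {f \<in> B \<rightarrow>\<^sub>E V. \<forall>Q\<in>T. sum f Q \<noteq> v}"
  define H where "H = {f \<in> A. sum f P = v}"
  have P: "P \<subseteq> B" "P \<noteq> {}" "finite P"
    using insert.prems fin finite_subset by auto
  have "finite (B \<rightarrow>\<^sub>E V)" using fin by (intro finite_PiE)
  then have finA: "finite A" by (rule rev_finite_subset) (auto simp: A_def)
  have V_pos: "card V > 0" using fin V0 by (auto simp: card_gt_0_iff)
  obtain r where r: "r \<in> P" using P by blast
  have rB: "r \<in> B" using r P by blast
  have rT: "r \<notin> Q" if "Q \<in> T" for Q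
    using that r insert.prems(2) insert.hyps(2) by (auto simp: pairwise_def disjnt_def)
  have "A \<subseteq> (\<Union>w\<in>V. (\<lambda>f. f(r := f r + w)) ` H)"
  proof
    fix f assume f: "f \<in> A"
    then have fV: "f x \<in> V" if "x \<in> B" for x using that unfolding A_def by auto
    have sV: "sum f Q \<in> V" if "Q \<subseteq> B" for Q
    proof -
      have "finite Q" using that fin finite_subset by blast
      then show ?thesis using that
        by (induction Q rule: finite_induct) (auto intro: V0 Vplus fV)
    qed
    \<comment> \<open>\<open>w\<close> is the amount by which the sum over \<open>P\<close> misses
      \<open>v\<close>; subtracting it at \<open>r\<close> gives \<open>g\<close>, which lies in
      \<open>H\<close>.\<close>
    define w where "w = sum f P - v"
    have w: "w \<in> V" "- w \<in> V" using sV[OF P(1)] v Vplus Vneg unfolding w_def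
      by (metis add_uminus_conv_diff, metis add_uminus_conv_diff minus_diff_eq)
    define g where "g = f(r := f r - w)"
    have "g \<in> B \<rightarrow>\<^sub>E V"
      using f w(2) Vplus[OF fV[OF rB] w(2)] rB unfolding A_def g_def by (auto simp: PiE_iff extensional_def)
    moreover have "sum g Q \<noteq> v" if "Q \<in> T" for Q
    proof -
      have "sum g Q = sum f Q" unfolding g_def using rT[OF that] by (intro sum.cong) auto
      then show ?thesis using f that unfolding A_def by auto
    qed
    moreover have "sum g P = v"
    proof -
      have "sum g P = g r + sum g (P - {r})" using P r by (simp add: sum.remove)
      also have "sum g (P - {r}) = sum f (P - {r})" unfolding g_def by (intro sum.cong) auto
      also have "g r + \<dots> = sum f P - w" using P r by (simp add: g_def sum.remove)
      finally show ?thesis by (simp add: w_def)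
    qed
    ultimately have "g \<in> H" unfolding H_def A_def by auto
    moreover have "f = g(r := g r + w)" unfolding g_def by auto
    ultimately show "f \<in> (\<Union>w\<in>V. (\<lambda>f. f(r := f r + w)) ` H)" using w by blast
  qed
  then have "card A \<le> card (\<Union>w\<in>V. (\<lambda>f. f(r := f r + w)) ` H)"
    using finA fin by (intro card_mono) (auto simp: H_def)
  also have "\<dots> \<le> (\<Sum>w\<in>V. card ((\<lambda>f. f(r := f r + w)) ` H))"
    using fin by (intro card_UN_le)
  also have "\<dots> \<le> (\<Sum>w\<in>V. card H)"
    using finA by (intro sum_mono card_image_le) (auto simp: H_def)
  finally have "card A \<le> card V * card H" by simp
  then have AH: "real (card A) / real (card V) \<le> real (card H)"
    using V_pos by (simp add: field_simps flip: of_nat_mult)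
  have "{f \<in> B \<rightarrow>\<^sub>E V. \<forall>Q\<in>insert P T. sum f Q \<noteq> v} = A - H"
    unfolding A_def H_def by auto
  then have "real (card {f \<in> B \<rightarrow>\<^sub>E V. \<forall>Q\<in>insert P T. sum f Q \<noteq> v}) = real (card A) - real (card H)"
    using finA by (simp add: H_def card_Diff_subset card_mono of_nat_diff)
  also have "\<dots> \<le> real (card A) * (1 - 1 / real (card V))"
    using AH by (simp add: algebra_simps)
  also have "\<dots> \<le> (real (card V) ^ card B * (1 - 1 / real (card V)) ^ card T) * (1 - 1 / real (card V))"
    using insert.IH insert.prems V_pos unfolding A_def
    by (intro mult_right_mono) (auto simp: pairwise_insert)
  finally show ?case using insert.hyps by (simp add: mult_ac)
qed

text \<open>Union bound over the pairs \<open>(u, v)\<close>: with \<open>q = card V\<close>, a pair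
  is missed by a proportion of at most \<open>(1 - 1 / q) ^ (N * q)\<close>, hence at most
  \<open>exp (- N)\<close>, of all functions, and there are fewer than \<open>exp N\<close>
  pairs.\<close>

lemma exists_covering_function:
  fixes B :: "'a::ab_group_add set" and V :: "'b::ab_group_add set"
  assumes fin: "finite H" "finite V" and "B \<subseteq> H" and B: "sidon B" and V0: "0 \<in> V"
    and Vplus: "\<And>x y. x \<in> V \<Longrightarrow> y \<in> V \<Longrightarrow> x + y \<in> V"
    and Vneg: "\<And>x. x \<in> V \<Longrightarrow> - x \<in> V"
    and many: "\<And>u. u \<in> H - B \<Longrightarrow> N * card V \<le> card (triples B u)"
    and small: "real (card H * card V) < exp (real N)"
  shows "\<exists>f \<in> B \<rightarrow> V. \<forall>u\<in>H - B. \<forall>v\<in>V. \<exists>P\<in>triples B u. sum f P = v"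
proof -
  define bad where "bad = (\<lambda>(u, v). {f \<in> B \<rightarrow>\<^sub>E V. \<forall>P\<in>triples B u. sum f P \<noteq> v})"
  define q where "q = real (card V)"
  have finB: "finite B" using fin \<open>B \<subseteq> H\<close> finite_subset by blast
  have q: "q \<ge> 1" using fin V0 by (auto simp: q_def Suc_le_eq card_gt_0_iff)
  have bad: "real (card (bad p)) \<le> q ^ card B * exp (- real N)" if p_in: "p \<in> (H - B) \<times> V" for p
  proof -
    obtain u v where p: "p = (u, v)" "u \<in> H - B" "v \<in> V" using p_in by auto
    have "finite (triples B u)" using finB by (simp add: triples_def)
    moreover have "disjoint (triples B u)"
      using triples_disjoint[OF B] by (auto simp: pairwise_def disjnt_def)
    ultimately have "real (card (bad p)) \<le> q ^ card B * (1 - 1 / q) ^ card (triples B u)"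
      unfolding bad_def p q_def prod.case using fin finB V0 Vplus Vneg p(3)
      by (intro card_avoiding_functions) (auto simp: triples_def)
    also have "(1 - 1 / q) ^ card (triples B u) \<le> (1 - 1 / q) ^ (N * card V)"
      using many[OF p(2)] q by (intro power_decreasing) auto
    also have "\<dots> \<le> exp (- (1 / q)) ^ (N * card V)"
      using q exp_ge_add_one_self[of "- (1 / q)"] by (intro power_mono) auto
    also have "\<dots> = exp (- real N)"
      using q by (simp add: q_def flip: exp_of_nat_mult)
    finally show ?thesis using q by (simp add: mult_left_mono)
  qed
  have "real (card (\<Union>p\<in>(H - B) \<times> V. bad p)) \<le> (\<Sum>p\<in>(H - B) \<times> V. real (card (bad p)))"
    using fin card_UN_le[of "(H - B) \<times> V" bad] by (simp flip: of_nat_sum)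
  also have "\<dots> \<le> (\<Sum>p\<in>(H - B) \<times> V. q ^ card B * exp (- real N))"
    by (intro sum_mono bad)
  also have "\<dots> \<le> real (card H * card V) * (q ^ card B * exp (- real N))"
    using fin q by (auto simp: card_cartesian_product intro!: mult_right_mono card_mono)
  also have "\<dots> < exp (real N) * (q ^ card B * exp (- real N))"
    using small q by (intro mult_strict_right_mono) auto
  also have "\<dots> = q ^ card B" by (simp add: exp_minus field_simps)
  also have "\<dots> = real (card (B \<rightarrow>\<^sub>E V))" using finB by (simp add: card_PiE q_def)
  finally have "card (\<Union>p\<in>(H - B) \<times> V. bad p) < card (B \<rightarrow>\<^sub>E V)" by simp
  moreover have "finite (\<Union>p\<in>(H - B) \<times> V. bad p)"
  proof (rule finite_subset)
    show "(\<Union>p\<in>(H - B) \<times> V. bad p) \<subseteq> B \<rightarrow>\<^sub>E V" by (auto simp: bad_def)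
    show "finite (B \<rightarrow>\<^sub>E V)" using fin finB by (intro finite_PiE)
  qed
  ultimately have "\<not> (B \<rightarrow>\<^sub>E V) \<subseteq> (\<Union>p\<in>(H - B) \<times> V. bad p)"
    using card_mono leD by blast
  then obtain f where f: "f \<in> B \<rightarrow>\<^sub>E V" "f \<notin> (\<Union>p\<in>(H - B) \<times> V. bad p)" by blast
  then have "\<exists>P\<in>triples B u. sum f P = v" if "u \<in> H - B" "v \<in> V" for u v
    using that f unfolding bad_def by blast
  then show ?thesis using f(1) by (intro bexI[of _ f]) auto
qed

section \<open>Maximal Sidon sets containing a graph\<close>

lemma exists_maximal_sidon_extension:
  assumes "finite G" "S0 \<subseteq> G" "sidon S0"
  shows "\<exists>S. S0 \<subseteq> S \<and> S \<subseteq> G \<and> sidon S \<and> (\<forall>S'\<subseteq>G. sidon S' \<longrightarrow> \<not> S \<subset> S')"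
proof -
  have "finite {S. S \<subseteq> G \<and> sidon S}" using assms(1) by simp
  then obtain S where "S \<in> {S. S \<subseteq> G \<and> sidon S}" "S0 \<subseteq> S"
      "\<forall>S'\<in>{S. S \<subseteq> G \<and> sidon S}. S \<subseteq> S' \<longrightarrow> S = S'"
    using assms finite_has_maximal2[of "{S. S \<subseteq> G \<and> sidon S}" S0] by blast
  then show ?thesis by blast
qed

lemma sidon_extension_of_graph:
  fixes B :: "'a::ab_group_add set" and V :: "'b::ab_group_add set"
  assumes two: "\<And>x::'a. x + x = 0" "\<And>x::'b. x + x = 0"
    and fin: "finite B" "finite V"
    and Vplus: "\<And>x y. x \<in> V \<Longrightarrow> y \<in> V \<Longrightarrow> x + y \<in> V"
    and f: "f \<in> B \<rightarrow> V"
    and cover: "\<And>u v. u \<in> H - B \<Longrightarrow> v \<in> V \<Longrightarrow> \<exists>P\<in>triples B u. sum f P = v"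
    and S: "sidon S" "(\<lambda>b. (b, f b)) ` B \<subseteq> S" "S \<subseteq> H \<times> V"
  shows "card S \<le> card B + card V"
proof -
  let ?S0 = "(\<lambda>b. (b, f b)) ` B"
  have cancel: "x + (x + y) = y" "x' + (x' + y') = y'" for x y :: 'a and x' y' :: 'b
    using two by (simp_all flip: add.assoc)
  have SB: "u \<in> B" if "(u, v) \<in> S" for u v
  proof (rule ccontr)
    assume u: "u \<notin> B"
    then have "u \<in> H - B" "v \<in> V" using that S(3) by auto
    then obtain P where P: "P \<in> triples B u" "sum f P = v" using cover by blast
    then obtain x y z where xyz: "P = {x, y, z}" "x \<noteq> y" "x \<noteq> z" "y \<noteq> z"
      unfolding triples_def by (auto simp: card_3_iff)
    have B: "x \<in> B" "y \<in> B" "z \<in> B" using P xyz by (auto simp: triples_def)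
    have "u = x + (y + z)" "v = f x + (f y + f z)" using P xyz by (auto simp: triples_def)
    \<comment> \<open>Moving \<open>(x, f x)\<close> to the other side turns the triple sum into two
      pairs of \<open>S\<close> with equal sums.\<close>
    then have "(u, v) + (x, f x) = (y, f y) + (z, f z)"
      by (simp add: ac_simps two cancel)
    then have "{(u, v), (x, f x)} = {(y, f y), (z, f z)}"
      using B S(2) that u xyz(4) by (intro sidonD[OF S(1)]) auto
    then have "(u, v) = (y, f y) \<or> (u, v) = (z, f z)" by blast
    then show False using u B by auto
  qed
  have "inj_on (\<lambda>(b, v). v + f b) (S - ?S0)"
  proof (rule inj_onI, clarify)
    fix b v b' v'
    assume 1: "(b, v) \<in> S" "(b, v) \<notin> ?S0" "(b', v') \<in> S" "(b', v') \<notin> ?S0" "v + f b = v' + f b'"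
    have b: "b \<in> B" "b' \<in> B" using 1 SB by auto
    \<comment> \<open>On both sides the first coordinate is 0, so the equality reduces to that of
      the two values of the map.\<close>
    have "(b, v) + (b, f b) = (b', v') + (b', f b')" using 1 two by simp
    then have "{(b, v), (b, f b)} = {(b', v'), (b', f b')}"
      using 1 b S(2) by (intro sidonD[OF S(1)]) auto
    then have "(b, v) = (b', v') \<or> (b, v) = (b', f b')" by blast
    then show "b = b' \<and> v = v'" using 1 b by blast
  qed
  moreover have "(\<lambda>(b, v). v + f b) ` (S - ?S0) \<subseteq> V"
  proof clarify
    fix b v assume "(b, v) \<in> S"
    then show "v + f b \<in> V" using SB S(3) f by (intro Vplus) auto
  qed
  ultimately have "card (S - ?S0) \<le> card V" using fin card_inj_on_le by blast
  moreover have "card ?S0 \<le> card B" using fin card_image_le by blast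
  moreover have "card S \<le> card (S - ?S0) + card ?S0"
    using S(2) card_Un_le[of "S - ?S0" ?S0] by (simp add: Un_absorb2)
  ultimately show ?thesis by linarith
qed

text \<open>A coincidence of pair sums in the graph projects to one in \<open>B\<close>, and points
  of a graph are determined by their projections.\<close>

lemma sidon_graph:
  fixes B :: "'a::ab_group_add set" and f :: "'a \<Rightarrow> 'b::ab_group_add"
  assumes "sidon B"
  shows "sidon ((\<lambda>b. (b, f b)) ` B)"
  unfolding sidon_def
proof (intro ballI impI)
  fix a b x y
  assume in_graph: "a \<in> (\<lambda>b. (b, f b)) ` B" "b \<in> (\<lambda>b. (b, f b)) ` B"
      "x \<in> (\<lambda>b. (b, f b)) ` B" "y \<in> (\<lambda>b. (b, f b)) ` B"
    and eq: "a + b = x + y \<and> a \<noteq> b \<and> x \<noteq> y"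
  have proj: "fst c \<in> B" "c = (fst c, f (fst c))" if "c \<in> (\<lambda>b. (b, f b)) ` B" for c
    using that by auto
  have "{fst a, fst b} = {fst x, fst y}"
  proof (rule sidonD[OF assms])
    show "fst a + fst b = fst x + fst y" using eq by (metis fst_add)
    show "fst a \<noteq> fst b" "fst x \<noteq> fst y" using eq in_graph proj(2) by metis+
  qed (use in_graph proj(1) in auto)
  then have "(\<lambda>b. (b, f b)) ` {fst a, fst b} = (\<lambda>b. (b, f b)) ` {fst x, fst y}" by simp
  then show "{a, b} = {x, y}" using in_graph proj(2) by simp
qed

section \<open>The cubic curve in characteristic 2\<close>

lemma char_2_imp_eq:
  fixes x y :: "'a::comm_ring_1"
  assumes "(2::'a) = 0" "x + y = 0"
  shows "x = y"
proof -
  have "x - y = x + y - 2 * y" by simp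
  then show ?thesis using assms by simp
qed

text \<open>As 3 = 1, \<open>a + b\<close> and \<open>a ^ 3 + b ^ 3\<close> determine
  \<open>a * b\<close> when \<open>a + b\<close> is nonzero, hence the pair as the roots of a
  quadratic.\<close>

lemma sidon_cubic_curve:
  fixes F :: "'a::field set"
  assumes two: "(2::'a) = 0"
  shows "sidon ((\<lambda>x. (x, x ^ 3)) ` F)"
proof -
  have key: "z = x \<or> z = y"
    if "x + y = z + w" "x ^ 3 + y ^ 3 = z ^ 3 + w ^ 3" "x \<noteq> y" for x y z w :: 'a
  proof -
    have cube: "3 * ((a + b) * (a * b)) = (a + b) ^ 3 - (a ^ 3 + b ^ 3)" for a b :: 'a
      by (simp add: power3_eq_cube algebra_simps)
    have "3 * ((x + y) * (x * y)) = 3 * ((x + y) * (z * w))"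
      using cube[of x y] cube[of z w] that(1,2) by simp
    moreover have "(3::'a) = 2 + 1" by simp
    moreover have "x + y \<noteq> 0" using that(3) char_2_imp_eq[OF two] by blast
    ultimately have "x * y = z * w" using two by simp
    \<comment> \<open>Equal sum and product make \<open>z\<close> a root of the monic quadratic with
      roots \<open>x\<close> and \<open>y\<close>.\<close>
    moreover have "(z - x) * (z - y) = z * z - z * (x + y) + x * y" by (simp add: algebra_simps)
    ultimately have "(z - x) * (z - y) = 0" using that(1) by (simp add: algebra_simps)
    then show ?thesis by auto
  qed
  show ?thesis unfolding sidon_def
  proof (intro ballI impI)
    fix p q r s
    assume in_curve: "p \<in> (\<lambda>x. (x, x ^ 3)) ` F" "q \<in> (\<lambda>x. (x, x ^ 3)) ` F"
        "r \<in> (\<lambda>x. (x, x ^ 3)) ` F" "s \<in> (\<lambda>x. (x, x ^ 3)) ` F"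
      and eq: "p + q = r + s \<and> p \<noteq> q \<and> r \<noteq> s"
    define a b x y where abxy: "a = fst p" "b = fst q" "x = fst r" "y = fst s"
    have proj: "c = (fst c, fst c ^ 3)" if "c \<in> (\<lambda>x. (x, x ^ 3)) ` F" for c
      using that by auto
    have pqrs: "p = (a, a ^ 3)" "q = (b, b ^ 3)" "r = (x, x ^ 3)" "s = (y, y ^ 3)"
      unfolding abxy using in_curve proj by blast+
    have sums: "a + b = x + y" "a ^ 3 + b ^ 3 = x ^ 3 + y ^ 3" "a \<noteq> b" using eq pqrs by auto
    have "x = a \<or> x = b" by (rule key[OF sums])
    then show "{p, q} = {r, s}"
    proof
      assume "x = a"
      then have "y = b" using sums(1) by simp
      then show ?thesis using \<open>x = a\<close> pqrs by simp
    next
      assume "x = b"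
      then have "y = a" using sums(1) by (simp add: add.commute)
      then show ?thesis using \<open>x = b\<close> pqrs by auto
    qed
  qed
qed

text \<open>Triples are counted by slopes: each element of \<open>F\<close> other than 0 and 1 is
  the slope of an ordered pair from some triple, and a triple has 9 ordered pairs, diagonal ones
  included.\<close>

lemma card_triples_cubic_curve:
  fixes F :: "'a::field set"
  defines "B \<equiv> (\<lambda>x. (x, x ^ 3)) ` F"
  assumes two: "(2::'a) = 0" and fin: "finite F"
    and Fplus: "\<And>x y. x \<in> F \<Longrightarrow> y \<in> F \<Longrightarrow> x + y \<in> F"
    and Fmult: "\<And>x y. x \<in> F \<Longrightarrow> y \<in> F \<Longrightarrow> x * y \<in> F"
    and Fdiv: "\<And>x y. x \<in> F \<Longrightarrow> y \<in> F \<Longrightarrow> x / y \<in> F"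
    and cube: "\<And>x. x \<in> F \<Longrightarrow> \<exists>y\<in>F. y ^ 3 = x"
    and u: "u \<in> F \<times> F - B"
  shows "card F \<le> 9 * card (triples B u) + 2"
proof -
  obtain a b where ab: "u = (a, b)" "a \<in> F" "b \<in> F" "b \<noteq> a ^ 3"
    using u unfolding B_def by auto
  define c where "c = a ^ 3 + b"
  have c: "c \<in> F" "c \<noteq> 0"
  proof -
    show "c \<in> F" unfolding c_def power3_eq_cube using ab by (intro Fplus Fmult)
    show "c \<noteq> 0" unfolding c_def using ab(4) char_2_imp_eq[OF two] by metis
  qed
  \<comment> \<open>The points of \<open>B\<close> over \<open>a + p\<close>, \<open>a + q\<close>, \<open>a + p + q\<close> sum to \<open>(a, b)\<close> iff \<open>p * q * (p + q) = c\<close>;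
    with \<open>q = p * t\<close> this reads \<open>p ^ 3 * (t ^ 2 + t) = c\<close>, which has one solution \<open>p\<close> for each \<open>t \<noteq> 0, 1\<close>.\<close>
  define slope :: "('a \<times> 'a) \<times> ('a \<times> 'a) \<Rightarrow> 'a"
    where "slope = (\<lambda>(p, q). (fst q - a) / (fst p - a))"
  have finT: "finite (triples B u)" using fin unfolding triples_def B_def by simp
  have finP: "finite P" if "P \<in> triples B u" for P
    using that unfolding triples_def by (auto intro: card_ge_0_finite)
  have "F - {0, 1} \<subseteq> (\<Union>P\<in>triples B u. slope ` (P \<times> P))"
  proof
    fix t assume t: "t \<in> F - {0, 1}"
    have "t ^ 2 + t = t * (t + 1)" by (simp add: power2_eq_square algebra_simps)
    moreover have "t + 1 \<noteq> 0" using t char_2_imp_eq[OF two] by blast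
    ultimately have t2: "t ^ 2 + t \<noteq> 0" using t by simp
    have "t ^ 2 + t \<in> F" using t unfolding power2_eq_square by (intro Fplus Fmult) auto
    then obtain p where p: "p \<in> F" "p ^ 3 = c / (t ^ 2 + t)" using cube Fdiv c by blast
    have p3: "p ^ 3 * (t ^ 2 + t) = a ^ 3 + b" using p(2) t2 by (simp add: c_def)
    have p0: "p \<noteq> 0" using p(2) t2 c by auto
    define x y z where "x = a + p" and "y = a + p * t" and "z = a + p + p * t"
    have xyz: "x \<in> F" "y \<in> F" "z \<in> F"
      unfolding x_def y_def z_def using ab p t by (auto intro!: Fplus Fmult)
    have ne: "x \<noteq> y" "x \<noteq> z" "y \<noteq> z" unfolding x_def y_def z_def using p0 t by auto
    have "x + (y + z) = a + 2 * (a + p + p * t)" unfolding x_def y_def z_def by (simp add: algebra_simps)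
    then have "x + (y + z) = a" using two by simp
    \<comment> \<open>The terms that vanish in characteristic 2 are gathered into an explicit
      multiple of 2; what remains equals \<open>b\<close>.\<close>
    moreover have "x ^ 3 + (y ^ 3 + z ^ 3) = p ^ 3 * (t ^ 2 + t) - a ^ 3
        + 2 * (2 * a ^ 3 + 3 * a ^ 2 * (p + p * t) + 3 * a * (p ^ 2 + (p * t) ^ 2 + p * (p * t))
          + p ^ 3 + (p * t) ^ 3 + p ^ 3 * (t ^ 2 + t))"
      unfolding x_def y_def z_def by (simp add: power3_eq_cube power2_eq_square algebra_simps)
    then have "x ^ 3 + (y ^ 3 + z ^ 3) = b" using two p3 by simp
    ultimately have "{(x, x ^ 3), (y, y ^ 3), (z, z ^ 3)} \<in> triples B u"
      unfolding triples_def B_def using xyz ne by (auto simp: ab(1))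
    moreover have "t = slope ((x, x ^ 3), (y, y ^ 3))"
      unfolding slope_def x_def y_def using p0 by simp
    ultimately show "t \<in> (\<Union>P\<in>triples B u. slope ` (P \<times> P))" by blast
  qed
  then have "card (F - {0, 1}) \<le> card (\<Union>P\<in>triples B u. slope ` (P \<times> P))"
    using finT finP by (intro card_mono) auto
  also have "\<dots> \<le> (\<Sum>P\<in>triples B u. card (slope ` (P \<times> P)))"
    using finT by (rule card_UN_le)
  also have "\<dots> \<le> (\<Sum>P\<in>triples B u. 9)"
  proof (rule sum_mono)
    fix P assume P: "P \<in> triples B u"
    then have "card (slope ` (P \<times> P)) \<le> card (P \<times> P)" using finP by (intro card_image_le) auto
    then show "card (slope ` (P \<times> P)) \<le> 9"
      using P by (simp add: card_cartesian_product triples_def)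
  qed
  finally have "card (F - {0, 1}) \<le> 9 * card (triples B u)" by simp
  \<comment> \<open>The two omitted slopes 0 and 1 account for the summand 2.\<close>
  moreover have "card F \<le> card (F - {0, 1}) + card {0, 1 :: 'a}"
    using card_Un_le[of "F - {0, 1}" "{0, 1}"] fin card_mono[of "F - {0, 1} \<union> {0, 1}" F]
    by (auto intro: order_trans)
  ultimately show ?thesis by simp
qed

section \<open>Finite fields of characteristic 2 inside an algebraically closed field\<close>

text \<open>Over an algebraically closed field of characteristic 2 and for \<open>m > 0\<close>,
  this is the subfield with \<open>2 ^ m\<close> elements; as sets, such fields of different orders
  share one type.\<close>

definition frobenius_fixed :: "nat \<Rightarrow> 'a::field set" where
  "frobenius_fixed m = {x. x ^ (2 ^ m) = x}"

lemma frobenius_fixed_closed: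
  fixes x y :: "'a::field"
  assumes "x \<in> frobenius_fixed m" "y \<in> frobenius_fixed m"
  shows "x * y \<in> frobenius_fixed m" "x / y \<in> frobenius_fixed m"
    and "CHAR('a) = 2 \<Longrightarrow> x + y \<in> frobenius_fixed m"
  using assms freshmans_dream'[of "2 ^ m" m x y]
  by (auto simp: frobenius_fixed_def power_mult_distrib power_divide)

text \<open>With \<open>q = 2 ^ m\<close>, the polynomial \<open>X ^ q - X\<close> splits into
  \<open>q\<close> linear factors, which are distinct because its derivative is the constant
  -1.\<close>

lemma frobenius_fixed_card:
  assumes "CHAR('a::alg_closed_field) = 2" "m > 0"
  shows "card (frobenius_fixed m :: 'a set) = 2 ^ m"
proof -
  define q where "q = (2::nat) ^ m"
  have q: "q \<ge> 2" using assms(2) unfolding q_def by (cases m) auto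
  define p :: "'a poly" where "p = monom 1 q - monom 1 1"
  have deg: "degree p = q"
    unfolding p_def diff_conv_add_uminus using q
    by (subst degree_add_eq_left) (auto simp: degree_monom_eq)
  then have "p \<noteq> 0" using q by auto
  then obtain A where A: "size A = q" "p = smult (lead_coeff p) (\<Prod>x\<in>#A. [:-x, 1:])"
    using alg_closed_imp_factorization deg by metis
  have eval: "poly p x = x ^ q - x" for x by (simp add: p_def poly_monom)
  have lc: "lead_coeff p \<noteq> 0" using \<open>p \<noteq> 0\<close> by simp
  have roots: "set_mset A = frobenius_fixed m"
  proof -
    have "poly p x = 0 \<longleftrightarrow> x \<in># A" for x
      using lc by (subst A(2)) (auto simp: poly_prod_mset prod_mset_zero_iff)
    then show ?thesis using eval unfolding frobenius_fixed_def q_def by auto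
  qed
  have "of_nat q = (0::'a)"
    unfolding of_nat_eq_0_iff_char_dvd using assms by (simp add: q_def)
  then have deriv: "poly (pderiv p) x = - 1" for x
    by (simp add: p_def pderiv_diff pderiv_monom poly_monom)
  have "count A x \<le> 1" for x
  proof (rule ccontr)
    assume "\<not> count A x \<le> 1"
    then have "{#x, x#} \<subseteq># A" by (auto simp: subseteq_mset_def)
    then obtain A' where "A = {#x, x#} + A'" by (metis subset_mset.le_iff_add)
    \<comment> \<open>A factor of multiplicity 2 makes \<open>x\<close> a root of the derivative as
      well.\<close>
    then have "p = [:-x, 1:] * ([:-x, 1:] * smult (lead_coeff p) (\<Prod>x\<in>#A'. [:-x, 1:]))"
      using A(2) by (simp add: mult_ac)
    then obtain r where "p = [:-x, 1:] * ([:-x, 1:] * r)" by blast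
    then have "poly (pderiv p) x = 0" by (simp only: pderiv_mult poly_add poly_mult) simp
    then show False using deriv by simp
  qed
  then have "count A x = 1" if "x \<in># A" for x
    using that by (simp add: le_antisym Suc_le_eq)
  then have "size A = card (set_mset A)" by (simp add: size_multiset_overloaded_eq)
  then show ?thesis using A(1) roots by (simp add: q_def)
qed

text \<open>For odd \<open>j\<close>, 3 does not divide \<open>2 ^ j - 1\<close>, so the field has
  no cube root of unity except 1; cubing is then injective, and surjective by finiteness.\<close>

lemma frobenius_fixed_cube_surj:
  assumes char: "CHAR('a::alg_closed_field) = 2" and "odd j" and x: "x \<in> frobenius_fixed j"
  shows "\<exists>y\<in>frobenius_fixed j. y ^ 3 = (x::'a)"
proof -
  let ?F = "frobenius_fixed j :: 'a set"
  have j: "j > 0" using \<open>odd j\<close> by (cases j) auto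
  have fin: "finite ?F" using frobenius_fixed_card[OF char j] by (intro card_ge_0_finite) simp
  obtain k where k: "(2::nat) ^ j = 3 * k + 2"
  proof -
    obtain i where i: "j = 2 * i + 1" using \<open>odd j\<close> by (elim oddE)
    have "\<exists>k. (2::nat) ^ (2 * i + 1) = 3 * k + 2"
    proof (induction i)
      case (Suc i)
      then obtain k where "(2::nat) ^ (2 * i + 1) = 3 * k + 2" by blast
      then have "(2::nat) ^ (2 * Suc i + 1) = 3 * (4 * k + 2) + 2" by simp
      then show ?case by blast
    qed simp
    then show thesis using that i by blast
  qed
  have "inj_on (\<lambda>y. y ^ 3) ?F"
  proof (rule inj_onI)
    fix y z assume yz: "y \<in> ?F" "z \<in> ?F" "y ^ 3 = z ^ 3"
    show "y = z"
    proof (cases "z = 0")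
      case True
      then show ?thesis using yz by simp
    next
      case False
      define t where "t = y / z"
      have "t \<in> ?F" unfolding t_def using yz by (intro frobenius_fixed_closed)
      \<comment> \<open>Since \<open>t ^ 3 = 1\<close>, the exponent \<open>3 * k + 2\<close>
        reduces to 2, whence \<open>t * t = t\<close>.\<close>
      then have "t ^ (3 * k + 2) = t" using k by (simp add: frobenius_fixed_def)
      moreover have t3: "t ^ 3 = 1" unfolding t_def using yz False by (simp add: power_divide)
      ultimately have "t * t = t" by (simp only: power_add power_mult power2_eq_square) simp
      moreover have "t \<noteq> 0" using t3 by auto
      ultimately have "t = 1" by simp
      then show ?thesis using False by (simp add: t_def)
    qed
  qed
  moreover have "(\<lambda>y. y ^ 3) ` ?F \<subseteq> ?F"
    unfolding power3_eq_cube by (auto intro!: frobenius_fixed_closed)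
  ultimately have "(\<lambda>y. y ^ 3) ` ?F = ?F" using fin endo_inj_surj by blast
  then show ?thesis using x by (metis (no_types, lifting) imageE)
qed

section \<open>Coordinates on elementary abelian 2-groups and transfer to bit vectors\<close>

lemma card_carrier_vec_bit: "card (carrier_vec n :: bit vec set) = 2 ^ n"
proof (induction n)
  case 0
  have "carrier_vec 0 = {vNil :: bit vec}" by auto
  then show ?case by simp
next
  case (Suc n)
  have "carrier_vec (Suc n) = (\<lambda>(c, v). vCons c v) ` ((UNIV :: bit set) \<times> carrier_vec n)"
  proof
    show "carrier_vec (Suc n) \<subseteq> (\<lambda>(c, v). vCons c v) ` ((UNIV :: bit set) \<times> carrier_vec n)"
    proof
      fix v :: "bit vec" assume "v \<in> carrier_vec (Suc n)"
      then show "v \<in> (\<lambda>(c, v). vCons c v) ` (UNIV \<times> carrier_vec n)"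
        by (cases v rule: vec_cases) auto
    qed
  qed auto
  moreover have "inj_on (\<lambda>(c, v). vCons c v) ((UNIV :: bit set) \<times> carrier_vec n)"
    by (auto simp: inj_on_def)
  moreover have "(UNIV :: bit set) = {0, 1}" using bit.exhaust by auto
  then have "card (UNIV :: bit set) = 2" by (metis card_2_iff zero_neq_one)
  ultimately show ?case by (simp add: card_image card_cartesian_product Suc.IH)
qed

text \<open>An additive embedding of the vectors of dimension \<open>m\<close> is built by induction
  on \<open>m\<close>, each step adjoining an element outside the image so far; at
  \<open>m = n\<close> it is onto by cardinality.\<close>

lemma elementary_abelian_2_group_coordinates:
  fixes G :: "'a::ab_group_add set"
  assumes two: "\<And>x::'a. x + x = 0" and "0 \<in> G"
    and Gplus: "\<And>x y. x \<in> G \<Longrightarrow> y \<in> G \<Longrightarrow> x + y \<in> G"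
    and card: "card G = 2 ^ n"
  shows "\<exists>\<psi> :: bit vec \<Rightarrow> 'a. bij_betw \<psi> (carrier_vec n) G \<and>
    (\<forall>v\<in>carrier_vec n. \<forall>w\<in>carrier_vec n. \<psi> (v + w) = \<psi> v + \<psi> w)"
proof -
  have fin: "finite G" using card by (intro card_ge_0_finite) simp
  have "\<exists>\<psi> :: bit vec \<Rightarrow> 'a. \<psi> ` carrier_vec m \<subseteq> G \<and> inj_on \<psi> (carrier_vec m) \<and>
      (\<forall>v\<in>carrier_vec m. \<forall>w\<in>carrier_vec m. \<psi> (v + w) = \<psi> v + \<psi> w)" if "m \<le> n" for m
    using that
  proof (induction m)
    case 0
    have "carrier_vec 0 = {vNil :: bit vec}" by auto
    then show ?case using \<open>0 \<in> G\<close> by (intro exI[of _ "\<lambda>_. 0"]) auto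
  next
    case (Suc m)
    then obtain \<psi> :: "bit vec \<Rightarrow> 'a" where \<psi>: "\<psi> ` carrier_vec m \<subseteq> G" "inj_on \<psi> (carrier_vec m)"
      "\<And>v w. v \<in> carrier_vec m \<Longrightarrow> w \<in> carrier_vec m \<Longrightarrow> \<psi> (v + w) = \<psi> v + \<psi> w" by auto
    have "card (\<psi> ` carrier_vec m) = 2 ^ m" using \<psi>(2) by (simp add: card_image card_carrier_vec_bit)
    also have "\<dots> < card G" unfolding card using Suc.prems by simp
    finally have "\<psi> ` carrier_vec m \<noteq> G" by auto
    then obtain g where g: "g \<in> G" "g \<notin> \<psi> ` carrier_vec m" using \<psi>(1) by blast
    \<comment> \<open>A vector is split into coordinate 0 and the remaining \<open>m\<close> ones;
      coordinate 0 decides whether \<open>g\<close> is added.\<close>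
    define tl where "tl = (\<lambda>v :: bit vec. vec m (\<lambda>i. v $ Suc i))"
    define e where "e = (\<lambda>c :: bit. if c = 1 then g else 0)"
    have tl: "tl v \<in> carrier_vec m" for v unfolding tl_def by simp
    have tl_add: "tl (v + w) = tl v + tl w"
      if "v \<in> carrier_vec (Suc m)" "w \<in> carrier_vec (Suc m)" for v w
      using that unfolding tl_def by (intro eq_vecI) auto
    have e_add: "e (c + d) = e c + e d" for c d
      using two by (cases c; cases d) (auto simp: e_def)
    have vec_eq: "v = w"
      if "v \<in> carrier_vec (Suc m)" "w \<in> carrier_vec (Suc m)" "v $ 0 = w $ 0" "tl v = tl w"
      for v w :: "bit vec"
    proof (rule eq_vecI)
      fix i assume i: "i < dim_vec w"
      show "v $ i = w $ i"
      proof (cases i)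
        case (Suc k)
        then have "k < m" using i that(2) by simp
        then show ?thesis using arg_cong[OF that(4), of "\<lambda>u. vec_index u k"] Suc by (simp add: tl_def)
      qed (use that in simp)
    qed (use that in simp)
    have "inj_on (\<lambda>v. \<psi> (tl v) + e (v $ 0)) (carrier_vec (Suc m))"
    proof (rule inj_onI)
      fix v w :: "bit vec"
      assume vw: "v \<in> carrier_vec (Suc m)" "w \<in> carrier_vec (Suc m)"
        and eq: "\<psi> (tl v) + e (v $ 0) = \<psi> (tl w) + e (w $ 0)"
      have cancel: "x + (x + y) = y" for x y :: 'a using two by (simp flip: add.assoc)
      \<comment> \<open>With different heads, adding the two equal values exhibits \<open>g\<close>
        as a value of \<open>\<psi>\<close>, against its choice.\<close>
      have "g = \<psi> (tl v + tl w)" if "v $ 0 \<noteq> w $ 0"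
      proof -
        have "e (v $ 0) + e (w $ 0) = g"
          using that by (cases "v $ 0"; cases "w $ 0") (auto simp: e_def)
        moreover have "e (v $ 0) + e (w $ 0) = \<psi> (tl v) + (\<psi> (tl v) + e (v $ 0)) + e (w $ 0)"
          by (simp add: cancel)
        then have "e (v $ 0) + e (w $ 0) = \<psi> (tl v) + \<psi> (tl w)"
          unfolding eq by (simp add: add.assoc two)
        ultimately show ?thesis using \<psi>(3) tl by simp
      qed
      then have "v $ 0 = w $ 0" using g(2) tl by (metis add_carrier_vec imageI)
      moreover from this have "tl v = tl w" using eq tl inj_onD[OF \<psi>(2)] by simp
      ultimately show "v = w" using vec_eq vw by blast
    qed
    moreover have "(\<lambda>v. \<psi> (tl v) + e (v $ 0)) ` carrier_vec (Suc m) \<subseteq> G"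
    proof (rule image_subsetI)
      fix v :: "bit vec"
      show "\<psi> (tl v) + e (v $ 0) \<in> G"
        using \<psi>(1) tl g(1) \<open>0 \<in> G\<close> by (intro Gplus) (auto simp: e_def)
    qed
    moreover have "\<psi> (tl (v + w)) + e ((v + w) $ 0) = (\<psi> (tl v) + e (v $ 0)) + (\<psi> (tl w) + e (w $ 0))"
      if "v \<in> carrier_vec (Suc m)" "w \<in> carrier_vec (Suc m)" for v w :: "bit vec"
    proof -
      have head: "(v + w) $ 0 = v $ 0 + w $ 0" using that by (intro index_add_vec) auto
      show ?thesis unfolding head e_add tl_add[OF that] \<psi>(3)[OF tl tl] by (simp only: ac_simps)
    qed
    ultimately show ?case by (intro exI[of _ "\<lambda>v. \<psi> (tl v) + e (v $ 0)"]) blast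
  qed
  from this[of n] obtain \<psi> :: "bit vec \<Rightarrow> 'a" where \<psi>: "\<psi> ` carrier_vec n \<subseteq> G" "inj_on \<psi> (carrier_vec n)"
      "\<And>v w. v \<in> carrier_vec n \<Longrightarrow> w \<in> carrier_vec n \<Longrightarrow> \<psi> (v + w) = \<psi> v + \<psi> w" by auto
  have "\<psi> ` carrier_vec n = G"
    using \<psi>(1,2) fin card by (intro card_subset_eq) (simp_all add: card_image card_carrier_vec_bit)
  then show ?thesis using \<psi>(2,3) by (intro exI[of _ \<psi>]) (simp add: bij_betw_def)
qed

lemma sidon_set_iff_sidon_image:
  fixes \<psi> :: "bit vec \<Rightarrow> 'a::plus"
  assumes inj: "inj_on \<psi> (carrier_vec n)"
    and add: "\<And>v w. v \<in> carrier_vec n \<Longrightarrow> w \<in> carrier_vec n \<Longrightarrow> \<psi> (v + w) = \<psi> v + \<psi> w"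
    and S: "S \<subseteq> carrier_vec n"
  shows "sidon_set n S \<longleftrightarrow> sidon (\<psi> ` S)"
proof -
  have sum: "\<psi> a + \<psi> b = \<psi> x + \<psi> y \<longleftrightarrow> a + b = x + y" if "a \<in> S" "b \<in> S" "x \<in> S" "y \<in> S" for a b x y
  proof -
    have "a \<in> carrier_vec n" "b \<in> carrier_vec n" "x \<in> carrier_vec n" "y \<in> carrier_vec n"
      using that S by auto
    then show ?thesis using inj_onD[OF inj, of "a + b" "x + y"] by (auto simp: add[symmetric])
  qed
  have eq: "\<psi> a = \<psi> b \<longleftrightarrow> a = b" if "a \<in> S" "b \<in> S" for a b
    using inj_on_subset[OF inj S] that by (simp add: inj_on_eq_iff)
  have "(\<psi> a + \<psi> b = \<psi> x + \<psi> y \<and> \<psi> a \<noteq> \<psi> b \<and> \<psi> x \<noteq> \<psi> y \<longrightarrow> {\<psi> a, \<psi> b} = {\<psi> x, \<psi> y}) \<longleftrightarrow>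
      (a + b = x + y \<and> a \<noteq> b \<and> x \<noteq> y \<longrightarrow> {a, b} = {x, y})"
    if "a \<in> S" "b \<in> S" "x \<in> S" "y \<in> S" for a b x y
    using that by (simp add: sum eq doubleton_eq_iff)
  then show ?thesis using S unfolding sidon_set_def sidon_def by simp
qed

text \<open>The Sidon property only sees addition and equality, so an additive bijection carries it
  and maximality back to the vectors.\<close>

lemma maximal_sidon_set_transfer:
  fixes \<psi> :: "bit vec \<Rightarrow> 'a::plus"
  assumes bij: "bij_betw \<psi> (carrier_vec n) G"
    and add: "\<And>v w. v \<in> carrier_vec n \<Longrightarrow> w \<in> carrier_vec n \<Longrightarrow> \<psi> (v + w) = \<psi> v + \<psi> w"
    and S: "S \<subseteq> G" "sidon S" "\<forall>S'\<subseteq>G. sidon S' \<longrightarrow> \<not> S \<subset> S'"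
  shows "\<exists>R. maximal_sidon_set n R \<and> card R = card S"
proof -
  define R where "R = {v \<in> carrier_vec n. \<psi> v \<in> S}"
  have inj: "inj_on \<psi> (carrier_vec n)" and img: "\<psi> ` carrier_vec n = G"
    using bij by (auto simp: bij_betw_def)
  have R: "R \<subseteq> carrier_vec n" by (auto simp: R_def)
  have RS: "\<psi> ` R = S" using img S(1) by (auto simp: R_def)
  have "\<not> R \<subset> R'" if "sidon_set n R'" for R'
  proof
    assume "R \<subset> R'"
    have R': "R' \<subseteq> carrier_vec n" using that by (simp add: sidon_set_def)
    have "\<psi> ` R \<noteq> \<psi> ` R'" using \<open>R \<subset> R'\<close> inj_on_image_eq_iff[OF inj R R'] by simp
    moreover have "\<psi> ` R \<subseteq> \<psi> ` R'" using \<open>R \<subset> R'\<close> by (intro image_mono) auto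
    ultimately have "S \<subset> \<psi> ` R'" using RS by simp
    moreover have "sidon (\<psi> ` R')" using sidon_set_iff_sidon_image[OF inj add R'] that by simp
    moreover have "\<psi> ` R' \<subseteq> G" using R' img by blast
    ultimately show False using S(3) by blast
  qed
  moreover have "sidon_set n R" using sidon_set_iff_sidon_image[OF inj add R] S(2) RS by simp
  moreover have "card R = card S" using card_image[OF inj_on_subset[OF inj R]] RS by simp
  ultimately show ?thesis unfolding maximal_sidon_set_def by blast
qed

section \<open>The construction for suitable dimensions\<close>

text \<open>Supplies the characteristic of \<open>bit alg_closure\<close>, the field in which the
  construction takes place.\<close>

lemma CHAR_bit [simp]: "CHAR(bit) = 2"
proof (rule CHAR_eqI)
  show "2 dvd n" if "of_nat n = (0 :: bit)" for n
  proof -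
    have "even (of_nat n :: bit)" unfolding that by simp
    then show ?thesis by (simp only: even_of_nat_iff)
  qed
qed simp

text \<open>Fields \<open>F\<close> of order \<open>2 ^ j\<close> and \<open>V\<close> of order
  \<open>2 ^ m\<close> are taken in one algebraic closure, so that
  \<open>(F \<times> F) \<times> V\<close> has order \<open>2 ^ (2 * j + m)\<close>. The factor 18
  outweighs the 9 of the triple count.\<close>

lemma exists_maximal_sidon_set_card_le:
  assumes "odd j" "m > 0" and large: "18 * (2 * j + m) * 2 ^ m \<le> (2::nat) ^ j"
  shows "\<exists>S. maximal_sidon_set (2 * j + m) S \<and> card S \<le> 2 ^ j + 2 ^ m"
proof -
  define F where "F = (frobenius_fixed j :: bit alg_closure set)"
  define V where "V = (frobenius_fixed m :: bit alg_closure set)"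
  define B where "B = (\<lambda>x. (x, x ^ 3)) ` F"
  define n where "n = 2 * j + m"
  have char: "CHAR(bit alg_closure) = 2" by simp
  have "of_nat CHAR(bit alg_closure) = (0 :: bit alg_closure)" by (rule of_nat_CHAR)
  then have two: "(2 :: bit alg_closure) = 0" unfolding char by simp
  have double: "x + x = 0" for x :: "bit alg_closure" using two by (simp flip: mult_2)
  have neg: "- x = x" for x :: "bit alg_closure" using double by (rule minus_unique)
  have j: "j > 0" using \<open>odd j\<close> by (cases j) auto
  have cardF: "card F = 2 ^ j" and cardV: "card V = 2 ^ m"
    unfolding F_def V_def using char j \<open>m > 0\<close> by (simp_all add: frobenius_fixed_card)
  have fin: "finite F" "finite V" using cardF cardV by (auto intro: card_ge_0_finite)
  have F0: "0 \<in> F" and V0: "0 \<in> V" by (simp_all add: F_def V_def frobenius_fixed_def power_0_left)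
  have Fclosed: "x + y \<in> F" "x * y \<in> F" "x / y \<in> F" if "x \<in> F" "y \<in> F" for x y
    using frobenius_fixed_closed[of x j y] that char by (auto simp: F_def)
  have Vplus: "x + y \<in> V" if "x \<in> V" "y \<in> V" for x y
    using frobenius_fixed_closed(3)[of x m y] that char by (auto simp: V_def)
  have cube: "\<exists>y\<in>F. y ^ 3 = x" if "x \<in> F" for x
    using frobenius_fixed_cube_surj[OF char \<open>odd j\<close>] that by (simp add: F_def)
  have B: "B \<subseteq> F \<times> F" unfolding B_def power3_eq_cube using Fclosed by auto
  have sidonB: "sidon B" unfolding B_def using two by (rule sidon_cubic_curve)
  have many: "n * card V \<le> card (triples B u)" if "u \<in> F \<times> F - B" for u
  proof -
    have "card F \<le> 9 * card (triples B u) + 2"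
      unfolding B_def
      by (rule card_triples_cubic_curve[OF two fin(1) Fclosed cube that[unfolded B_def]])
    \<comment> \<open>This lets the factor 18 absorb the additive 2 of the triple count.\<close>
    moreover have "n * 2 ^ m \<ge> 1" using \<open>m > 0\<close> by (simp add: n_def)
    ultimately show ?thesis using large unfolding cardF cardV n_def by linarith
  qed
  \<comment> \<open>There are at most \<open>2 ^ n\<close> pairs \<open>(u, v)\<close>, so the union
    bound works with \<open>N = n\<close> because 2 < e.\<close>
  have "real (card (F \<times> F) * card V) = 2 ^ n"
    by (simp add: card_cartesian_product cardF cardV n_def power_add mult_2)
  also have "\<dots> < exp 1 ^ n"
    using exp_lower_Taylor_quadratic[of 1] \<open>m > 0\<close> by (intro power_strict_mono) (auto simp: n_def)
  also have "\<dots> = exp (real n)" by (simp flip: exp_of_nat_mult)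
  finally have small: "real (card (F \<times> F) * card V) < exp (real n)" .
  obtain f where f: "f \<in> B \<rightarrow> V"
    and cover: "\<And>u v. u \<in> F \<times> F - B \<Longrightarrow> v \<in> V \<Longrightarrow> \<exists>P\<in>triples B u. sum f P = v"
    using exists_covering_function[OF _ fin(2) B sidonB V0 Vplus _ many small] fin(1) neg by auto
  let ?G = "(F \<times> F) \<times> V"
  have finG: "finite ?G" using fin by simp
  have graph: "(\<lambda>b. (b, f b)) ` B \<subseteq> ?G" using B f by auto
  obtain S where S: "(\<lambda>b. (b, f b)) ` B \<subseteq> S" "S \<subseteq> ?G" "sidon S"
    "\<forall>S'\<subseteq>?G. sidon S' \<longrightarrow> \<not> S \<subset> S'"
    using exists_maximal_sidon_extension[OF finG graph sidon_graph[OF sidonB]]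
    by (elim exE conjE) (rule that)
  have double_prod: "p + p = 0" for p :: "bit alg_closure \<times> bit alg_closure"
    using double by (simp add: plus_prod_def zero_prod_def)
  have finB: "finite B" using fin by (simp add: B_def)
  have "card S \<le> card B + card V"
    by (rule sidon_extension_of_graph[OF double_prod double finB fin(2) Vplus f cover S(3,1,2)])
  also have "card B \<le> 2 ^ j" unfolding B_def using card_image_le[OF fin(1)] cardF by metis
  finally have card: "card S \<le> 2 ^ j + 2 ^ m" by (simp add: cardV)
  have "\<exists>\<psi> :: bit vec \<Rightarrow> _. bij_betw \<psi> (carrier_vec n) ?G \<and>
    (\<forall>v\<in>carrier_vec n. \<forall>w\<in>carrier_vec n. \<psi> (v + w) = \<psi> v + \<psi> w)"
  proof (rule elementary_abelian_2_group_coordinates)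
    show "p + p = 0" for p :: "(bit alg_closure \<times> bit alg_closure) \<times> bit alg_closure"
      using double by (simp add: plus_prod_def zero_prod_def)
    show "0 \<in> ?G" using F0 V0 by (simp add: zero_prod_def)
    show "p + q \<in> ?G" if "p \<in> ?G" "q \<in> ?G" for p q
      using that Fclosed(1) Vplus by (auto simp: plus_prod_def)
    show "card ?G = 2 ^ n"
      by (simp add: card_cartesian_product cardF cardV n_def power_add mult_2)
  qed
  then obtain \<psi> :: "bit vec \<Rightarrow> _" where \<psi>: "bij_betw \<psi> (carrier_vec n) ?G"
    "\<forall>v\<in>carrier_vec n. \<forall>w\<in>carrier_vec n. \<psi> (v + w) = \<psi> v + \<psi> w"
    by blast
  from maximal_sidon_set_transfer[OF \<psi>(1) \<psi>(2)[rule_format] S(2-4)] obtain R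
    where "maximal_sidon_set n R" "card R = card S" by blast
  then show ?thesis using card by (auto simp: n_def)
qed

section \<open>Choice of parameters and the final bound\<close>

text \<open>Makes \<open>m\<close> positive in the dimension split; 31 is the threshold, as the
  inequality fails at 30.\<close>

lemma square_le_two_power: "31 \<le> n \<Longrightarrow> 1152 ^ 2 * n ^ 2 \<le> (2::nat) ^ n"
proof (induction n rule: nat_induct_at_least)
  case (Suc n)
  have "31 * n \<le> n * n" using Suc.hyps by (intro mult_right_mono) auto
  moreover have "(Suc n) ^ 2 = n * n + 2 * n + 1" by (simp add: power2_eq_square)
  ultimately have "(Suc n) ^ 2 \<le> 2 * n ^ 2"
    using Suc.hyps unfolding power2_eq_square[of n] by linarith
  then have "1152 ^ 2 * (Suc n) ^ 2 \<le> 2 * (1152 ^ 2 * n ^ 2)" by simp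
  also have "\<dots> \<le> 2 * 2 ^ n" using Suc.IH by (rule mult_left_mono) simp
  finally show ?case by simp
qed simp

text \<open>\<open>j\<close> is the least odd number with \<open>18 * n * 2 ^ n \<le> 8 ^ j\<close>.
  Consecutive odd powers of 8 differ by a factor 64, so minimality gives the upper bound with 1152 =
  18 * 64. As \<open>2 ^ n = 2 ^ m * 4 ^ j\<close>, cancelling \<open>4 ^ j\<close> gives the
  condition on \<open>m\<close>.\<close>

lemma exists_dimension_split:
  assumes "n \<ge> 31"
  obtains j m :: nat where "odd j" "m > 0" "n = 2 * j + m"
    "18 * n * 2 ^ m \<le> (2::nat) ^ j" "8 ^ j < 1152 * n * (2::nat) ^ n"
proof -
  define Q where "Q = (\<lambda>k. 18 * n * 2 ^ n \<le> (8::nat) ^ (2 * k + 1))"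
  \<comment> \<open>Crude bounds show that \<open>Q\<close> holds at \<open>n\<close>, so that a
    least \<open>k\<close> exists.\<close>
  have "(32::nat) * 2 ^ n * 2 ^ n \<le> 8 ^ (2 * n + 1)"
  proof -
    have "(16::nat) \<le> 16 ^ n" using assms by (intro self_le_power) auto
    then have "32 * 4 ^ n \<le> 8 * 16 ^ n * (4::nat) ^ n" by (intro mult_right_mono) auto
    moreover have "(8::nat) ^ (2 * n + 1) = 8 * 16 ^ n * 4 ^ n"
      by (simp add: power_mult flip: power_mult_distrib)
    moreover have "(32::nat) * 2 ^ n * 2 ^ n = 32 * 4 ^ n" by (simp flip: power_mult_distrib)
    ultimately show ?thesis by linarith
  qed
  moreover have "18 * n \<le> 32 * (2::nat) ^ n" using less_exp[of n] by linarith
  then have "18 * n * 2 ^ n \<le> 32 * 2 ^ n * (2::nat) ^ n" by (rule mult_right_mono) simp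
  ultimately have "Q n" unfolding Q_def by linarith
  define k where "k = (LEAST k. Q k)"
  have Qk: "Q k" unfolding k_def using \<open>Q n\<close> by (rule LeastI)
  \<comment> \<open>The exponent 1 is too small, so \<open>k\<close> has a predecessor, at which
    \<open>Q\<close> fails.\<close>
  have "31 * 1 \<le> n * (2::nat) ^ n" using assms by (intro mult_mono) auto
  then have "\<not> Q 0" by (simp add: Q_def)
  then obtain k' where k': "k = Suc k'" using Qk by (cases k) auto
  then have "\<not> Q k'" unfolding k_def using not_less_Least by (metis lessI)
  define j where "j = 2 * k + 1"
  have upper: "8 ^ j < 1152 * n * (2::nat) ^ n"
    using \<open>\<not> Q k'\<close> unfolding Q_def j_def k' by simp
  \<comment> \<open>Squaring the upper bound yields \<open>8 ^ (2 * j) < 8 ^ n\<close>, so that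
    \<open>m = n - 2 * j\<close> is positive.\<close>
  have "(8::nat) ^ (2 * j) = (8 ^ j) ^ 2" by (simp add: power_mult mult.commute)
  also have "\<dots> < (1152 * n * 2 ^ n) ^ 2" using upper by (intro power_strict_mono) auto
  also have "\<dots> = 1152 ^ 2 * n ^ 2 * 4 ^ n"
    by (simp add: power_mult_distrib power2_eq_square flip: power_mult_distrib)
  also have "\<dots> \<le> 2 ^ n * 4 ^ n" using square_le_two_power[OF assms] by (intro mult_right_mono) auto
  also have "\<dots> = 8 ^ n" by (simp flip: power_mult_distrib)
  finally have "2 * j < n" by simp
  then obtain m where m: "m > 0" "n = 2 * j + m" using less_imp_add_positive by metis
  have "18 * n * 2 ^ n = 18 * n * 2 ^ m * (4::nat) ^ j"
    unfolding m(2) by (simp add: power_add power_mult)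
  moreover have "(8::nat) ^ j = 2 ^ j * 4 ^ j" by (simp flip: power_mult_distrib)
  ultimately have "18 * n * 2 ^ m * 4 ^ j \<le> 2 ^ j * (4::nat) ^ j"
    using Qk unfolding Q_def j_def[symmetric] by linarith
  then have "18 * n * 2 ^ m \<le> (2::nat) ^ j" by simp
  then show thesis using that[of j m] m upper by (simp add: j_def)
qed

theorem theorem3p1:
  "\<exists>C::real. C > 0 \<and>
     (\<forall>n::nat. n > 0 \<longrightarrow>
        (\<exists>S. maximal_sidon_set n S \<and>
             real (card S) \<le> C * (real n * 2 ^ n) powr (1 / 3)))"
proof (intro exI[of _ "2 ^ 31"] conjI allI impI)
  \<comment> \<open>The constant \<open>2 ^ 31\<close> serves \<open>n < 31\<close>, where every
    subset has at most \<open>2 ^ n\<close> elements; for larger \<open>n\<close> already 22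
    suffices.\<close>
  fix n :: nat assume n: "n > 0"
  let ?r = "(real n * 2 ^ n) powr (1 / 3)"
  have "real n * 2 ^ n \<ge> 1 * 1" using n by (intro mult_mono) auto
  then have r: "?r \<ge> 1" by (simp add: ge_one_powr_ge_zero)
  show "\<exists>S. maximal_sidon_set n S \<and> real (card S) \<le> 2 ^ 31 * ?r"
  proof (cases "n \<ge> 31")
    case True
    then obtain j m where jm: "odd j" "m > 0" "n = 2 * j + m"
      "18 * n * 2 ^ m \<le> (2::nat) ^ j" "8 ^ j < 1152 * n * (2::nat) ^ n"
      by (rule exists_dimension_split)
    obtain S where S: "maximal_sidon_set n S" "card S \<le> 2 ^ j + 2 ^ m"
      using exists_maximal_sidon_set_card_le[OF jm(1,2)] jm(3,4) by auto
    \<comment> \<open>\<open>2 ^ m\<close> is at most \<open>2 ^ j\<close>, so it remains to bound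
      \<open>2 ^ j\<close> by a multiple of the cube root.\<close>
    have "1 * 2 ^ m \<le> 18 * n * (2::nat) ^ m" using n by (intro mult_right_mono) auto
    then have "card S \<le> 2 * 2 ^ j" using S(2) jm(4) by linarith
    then have "real (card S) \<le> 2 * 2 ^ j" using of_nat_mono[where 'a = real] by fastforce
    moreover have "(2::real) ^ j \<le> 11 * ?r"
    proof (rule power_le_imp_le_base[of _ 2])
      have "((2::real) ^ j) ^ Suc 2 = real (8 ^ j)"
        by (simp add: power_mult[symmetric] mult.commute[of j]) (simp add: power_mult)
      also have "\<dots> \<le> real (1152 * n * 2 ^ n)" using jm(5) by (simp only: of_nat_le_iff)
      \<comment> \<open>11 is the least integer whose cube, 1331, reaches 1152.\<close>
      also have "\<dots> \<le> 11 ^ 3 * (real n * 2 ^ n)" by simp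
      also have "\<dots> = 11 ^ 3 * ?r ^ 3"
        using n by (simp add: powr_powr flip: powr_realpow')
      also have "\<dots> = (11 * ?r) ^ Suc 2" by (simp add: power_mult_distrib)
      finally show "((2::real) ^ j) ^ Suc 2 \<le> (11 * ?r) ^ Suc 2" .
    qed simp
    ultimately have "real (card S) \<le> 22 * ?r" by linarith
    also have "\<dots> \<le> 2 ^ 31 * ?r" using r by (intro mult_right_mono) auto
    finally show ?thesis using S(1) by blast
  next
    case False
    have fin: "finite (carrier_vec n :: bit vec set)"
      by (rule card_ge_0_finite) (simp add: card_carrier_vec_bit)
    have sidon_iff: "sidon_set n S \<longleftrightarrow> S \<subseteq> carrier_vec n \<and> sidon S" for S
      by (simp add: sidon_set_def sidon_def)
    have "sidon ({} :: bit vec set)" by (simp add: sidon_def)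
    from exists_maximal_sidon_extension[OF fin empty_subsetI this]
    obtain S where S: "S \<subseteq> carrier_vec n" "sidon S"
      "\<forall>S'\<subseteq>carrier_vec n. sidon S' \<longrightarrow> \<not> S \<subset> (S' :: bit vec set)"
      by (elim exE conjE) (rule that)
    then have "maximal_sidon_set n S" unfolding maximal_sidon_set_def sidon_iff by blast
    moreover have "real (card S) \<le> 2 ^ 31 * ?r"
    proof -
      have "card S \<le> 2 ^ n"
        using S(1) fin card_mono card_carrier_vec_bit by metis
      then have "real (card S) \<le> 2 ^ n" using of_nat_mono[where 'a = real] by fastforce
      also have "(2::real) ^ n \<le> 2 ^ 31" using False by (intro power_increasing) auto
      also have "\<dots> \<le> 2 ^ 31 * ?r" using r by simp
      finally show ?thesis .
    qed
    ultimately show ?thesis by blast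
  qed
qed simp

end
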